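(* Let $X_1\ldots X_n$ and $Y_1\ldots Y_n$ be two strings over a finite alphabet, let $k=L_n\ge1$ be the length of their longest common subsequence, and let $\{(i_1^\alpha,j_1^\alpha),\ldots,(i_k^\alpha,j_k^\alpha)\}$, $\alpha\in A$, be all the optimal alignments. Then the highest alignment procedure (defined in the context) produces an optimal alignment $$\{(i_1^h,j_1^h),\ldots,(i_k^h,j_k^h)\},$$ where, for every $t=1,\ldots,k$, the pair $(i_t^h,j_t^h)$ can be obtained as $$j^h_t=\max\{j_t^\alpha:\alpha\in A\},\qquad i_t^h=\min\{i_t^\alpha: j_t^\alpha=j_t^h,\ \alpha\in A\}.$$
   Context: An alignment of $X_1\ldots X_n$ and $Y_1\ldots Y_n$ is a set of pairs $\{(i_1,j_1),\ldots,(i_k,j_k)\}$ with $1\le i_1<\cdots<i_k\le n$, $1\le j_1<\cdots<j_k\le n$ and $X_{i_t}=Y_{j_t}$ for all $t$. The largest possible $k$ is $L_n$, and an alignment with $k=L_n$ is called optimal. $A$ is the index set of all optimal alignments, each with its pairs listed in increasing order. Highest alignment procedure. Put $j_k^h:=\max_{\alpha\in A}j_k^\alpha$ and $i_k^h:=\min\{i_k^\alpha: j_k^\alpha=j_k^h,\ \alpha\in A\}$. Then, recursively for $t=k-1,k-2,\ldots,1$, put $$j_t^h:=\max\{j_l^\alpha:\ i_l^\alpha<i_{t+1}^h,\ \alpha\in A,\ l=1,\ldots,k\},\qquad i_t^h:=\min\{i_l^\alpha:\ j_l^\alpha=j_t^h,\ \alpha\in A,\ l=1,\ldots,k\}.$$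 The claim includes that this recursion can be carried out for all $k$ steps. *)

theory Defs
  imports Main
begin

text \<open>
  Strings are lists, while positions in them are counted from 1, so that the letter at position
  \<open>i\<close> of \<open>X\<close> is \<open>X ! (i - 1)\<close>.
\<close>

definition alignment_seq ::
  "'a list \<Rightarrow> 'a list \<Rightarrow> nat \<Rightarrow> (nat \<Rightarrow> nat) \<Rightarrow> (nat \<Rightarrow> nat) \<Rightarrow> bool" where
  "alignment_seq X Y k i j \<longleftrightarrow>
     strict_mono_on {1..k} i \<and> strict_mono_on {1..k} j \<and>
     (\<forall>t\<in>{1..k}. i t \<in> {1..length X} \<and> j t \<in> {1..length Y} \<and> X ! (i t - 1) = Y ! (j t - 1))"

definition alignments :: "'a list \<Rightarrow> 'a list \<Rightarrow> nat \<Rightarrow> (nat \<times> nat) set set" where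
  "alignments X Y k = {(\<lambda>t. (i t, j t)) ` {1..k} | i j. alignment_seq X Y k i j}"

definition lcs_length :: "'a list \<Rightarrow> 'a list \<Rightarrow> nat" where
  "lcs_length X Y = Max {k. alignments X Y k \<noteq> {}}"

definition optimal_alignments :: "'a list \<Rightarrow> 'a list \<Rightarrow> (nat \<times> nat) set set" where
  "optimal_alignments X Y = alignments X Y (lcs_length X Y)"

text \<open>
  \<open>i_at \<alpha> t\<close> and \<open>j_at \<alpha> t\<close> are the components of the \<open>t\<close>-th pair (counted from 1) of \<open>\<alpha>\<close> in
  increasing order. As both components increase along an alignment, they can be sorted separately;
  see \<open>i_at_alignment\<close> and \<open>j_at_alignment\<close> below.
\<close>

definition i_at :: "(nat \<times> nat) set \<Rightarrow> nat \<Rightarrow> nat" where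
  "i_at \<alpha> t = sorted_list_of_set (fst ` \<alpha>) ! (t - 1)"

definition j_at :: "(nat \<times> nat) set \<Rightarrow> nat \<Rightarrow> nat" where
  "j_at \<alpha> t = sorted_list_of_set (snd ` \<alpha>) ! (t - 1)"

lemma sorted_list_of_set_image_strict_mono:
  fixes f :: "nat \<Rightarrow> nat"
  assumes "strict_mono_on {1..k} f"
  shows "sorted_list_of_set (f ` {1..k}) = map f [1..<Suc k]"
proof -
  have "sorted_wrt (<) (map f [1..<Suc k])"
    using assms unfolding sorted_wrt_map
    by (intro sorted_wrt_mono_rel[OF _ sorted_wrt_upt]) (auto simp: strict_mono_on_def)
  then have "sorted_list_of_set (set (map f [1..<Suc k])) = map f [1..<Suc k]"
    by (intro sorted_list_of_set.idem_if_sorted_distinct) (simp_all add: strict_sorted_iff del: upt_Suc)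
  moreover have "set (map f [1..<Suc k]) = f ` {1..k}"
    by auto
  ultimately show ?thesis
    by simp
qed

lemma i_at_alignment:
  assumes "alignment_seq X Y k i j" "t \<in> {1..k}"
  shows "i_at ((\<lambda>t. (i t, j t)) ` {1..k}) t = i t"
proof -
  have "sorted_list_of_set (i ` {1..k}) = map i [1..<Suc k]"
    using assms(1) unfolding alignment_seq_def by (blast intro: sorted_list_of_set_image_strict_mono)
  moreover have "map i [1..<Suc k] ! (t - 1) = i t"
    using assms(2) by (cases t) (auto simp: nth_map simp del: upt_Suc)
  ultimately show ?thesis
    by (simp add: i_at_def image_image del: upt_Suc)
qed

lemma j_at_alignment:
  assumes "alignment_seq X Y k i j" "t \<in> {1..k}"
  shows "j_at ((\<lambda>t. (i t, j t)) ` {1..k}) t = j t"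
proof -
  have "sorted_list_of_set (j ` {1..k}) = map j [1..<Suc k]"
    using assms(1) unfolding alignment_seq_def by (blast intro: sorted_list_of_set_image_strict_mono)
  moreover have "map j [1..<Suc k] ! (t - 1) = j t"
    using assms(2) by (cases t) (auto simp: nth_map simp del: upt_Suc)
  ultimately show ?thesis
    by (simp add: j_at_def image_image del: upt_Suc)
qed

lemma finite_alignments: "finite (alignments X Y k)"
proof (rule finite_subset)
  show "alignments X Y k \<subseteq> Pow ({1..length X} \<times> {1..length Y})"
    by (auto simp: alignments_def alignment_seq_def)
qed simp

lemma optimal_alignments_nonempty: "optimal_alignments X Y \<noteq> {}"
proof -
  have "k \<le> length X" if nonempty: "alignments X Y k \<noteq> {}" for k
  proof -
    obtain i j where s: "alignment_seq X Y k i j"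
      using nonempty unfolding alignments_def by blast
    then have "inj_on i {1..k}"
      by (simp add: alignment_seq_def strict_mono_on_imp_inj_on)
    moreover have "i ` {1..k} \<subseteq> {1..length X}"
      using s by (auto simp: alignment_seq_def)
    ultimately show ?thesis
      using card_inj_on_le[of i "{1..k}" "{1..length X}"] by simp
  qed
  then have "finite {k. alignments X Y k \<noteq> {}}"
    by (auto intro: finite_subset[of _ "{..length X}"])
  moreover have "0 \<in> {k. alignments X Y k \<noteq> {}}"
    by (simp add: alignments_def alignment_seq_def strict_mono_on_def)
  ultimately show ?thesis
    using Max_in[of "{k. alignments X Y k \<noteq> {}}"] by (auto simp: optimal_alignments_def lcs_length_def)
qed

text \<open>
  The sets over which the highest alignment procedure maximises and minimises, first for its
  starting step and then for a recursive step; the argument \<open>i'\<close> is the first component of the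
  pair chosen one step before, and \<open>j\<close> is the maximum just found.
\<close>

definition start_js :: "'a list \<Rightarrow> 'a list \<Rightarrow> nat set" where
  "start_js X Y = {j_at \<alpha> (lcs_length X Y) | \<alpha>. \<alpha> \<in> optimal_alignments X Y}"

definition start_is :: "'a list \<Rightarrow> 'a list \<Rightarrow> nat \<Rightarrow> nat set" where
  "start_is X Y j = {i_at \<alpha> (lcs_length X Y) | \<alpha>.
     j_at \<alpha> (lcs_length X Y) = j \<and> \<alpha> \<in> optimal_alignments X Y}"

definition step_js :: "'a list \<Rightarrow> 'a list \<Rightarrow> nat \<Rightarrow> nat set" where
  "step_js X Y i' = {j_at \<alpha> l | \<alpha> l.
     i_at \<alpha> l < i' \<and> \<alpha> \<in> optimal_alignments X Y \<and> l \<in> {1..lcs_length X Y}}"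

definition step_is :: "'a list \<Rightarrow> 'a list \<Rightarrow> nat \<Rightarrow> nat set" where
  "step_is X Y j = {i_at \<alpha> l | \<alpha> l.
     j_at \<alpha> l = j \<and> \<alpha> \<in> optimal_alignments X Y \<and> l \<in> {1..lcs_length X Y}}"

text \<open>
  The procedure runs downwards from \<open>t = k\<close>, where \<open>k = lcs_length X Y\<close>; \<open>highest_pair X Y s\<close> is
  the pair found after \<open>s\<close> recursive steps, i.e. the one with index \<open>t = k - s\<close>.
\<close>

primrec highest_pair :: "'a list \<Rightarrow> 'a list \<Rightarrow> nat \<Rightarrow> nat \<times> nat" where
  "highest_pair X Y 0 =
     (let j = Max (start_js X Y) in (Min (start_is X Y j), j))"
| "highest_pair X Y (Suc s) =
     (let j = Max (step_js X Y (fst (highest_pair X Y s))) in (Min (step_is X Y j), j))"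

definition i_high :: "'a list \<Rightarrow> 'a list \<Rightarrow> nat \<Rightarrow> nat" where
  "i_high X Y t = fst (highest_pair X Y (lcs_length X Y - t))"

definition j_high :: "'a list \<Rightarrow> 'a list \<Rightarrow> nat \<Rightarrow> nat" where
  "j_high X Y t = snd (highest_pair X Y (lcs_length X Y - t))"

text \<open>
  \<open>Max\<close> and \<open>Min\<close> are total functions, meaningful on finite nonempty sets only. The procedure
  can be carried out if every maximum and minimum it takes exists.
\<close>

definition highest_procedure_defined :: "'a list \<Rightarrow> 'a list \<Rightarrow> bool" where
  "highest_procedure_defined X Y \<longleftrightarrow>
     (let k = lcs_length X Y; ok = (\<lambda>S :: nat set. finite S \<and> S \<noteq> {}) in
       ok (start_js X Y) \<and> ok (start_is X Y (j_high X Y k)) \<and>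
       (\<forall>t\<in>{1..<k}. ok (step_js X Y (i_high X Y (t + 1))) \<and> ok (step_is X Y (j_high X Y t))))"

end

theory Submission
  imports Defs
begin

text \<open>
  For two optimal alignments \<open>\<alpha>\<close> and \<open>\<beta>\<close>, the \<open>t\<close>-th pair of \<open>\<alpha>\<close> cannot lie strictly below the
  \<open>t\<close>-th pair of \<open>\<beta>\<close> in both coordinates, as the first \<open>t\<close> pairs of \<open>\<alpha>\<close> followed by the pairs of
  \<open>\<beta>\<close> from the \<open>t\<close>-th on would then form an alignment of length \<open>k + 1\<close>. Hence an alignment that
  maximises the \<open>t\<close>-th \<open>j\<close> and, among those, minimises the \<open>t\<close>-th \<open>i\<close>, in fact minimises the
  \<open>t\<close>-th \<open>i\<close> among all optimal alignments. Both coordinates of these extremal pairs therefore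
  increase with \<open>t\<close>. In a recursive step, the constraint \<open>i\<^sub>l < i\<^sub>t\<^sub>+\<^sub>1\<close> admits only indices
  \<open>l \<le> t\<close>, and the constraint \<open>j\<^sub>l = j\<^sub>t\<close> only indices \<open>l \<ge> t\<close>, so that by monotonicity the index
  \<open>l = t\<close> already realises the extrema.
\<close>

section \<open>Splicing two alignments\<close>

lemma alignments_le_lcs_length:
  assumes "alignments X Y m \<noteq> {}"
  shows "m \<le> lcs_length X Y"
proof -
  have "l \<le> length X" if "alignments X Y l \<noteq> {}" for l
  proof -
    obtain i j where s: "alignment_seq X Y l i j"
      using \<open>alignments X Y l \<noteq> {}\<close> unfolding alignments_def by blast
    then have "inj_on i {1..l}" "i ` {1..l} \<subseteq> {1..length X}"
      by (auto simp: alignment_seq_def strict_mono_on_imp_inj_on)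
    then show ?thesis
      using card_inj_on_le[of i "{1..l}" "{1..length X}"] by simp
  qed
  then have "finite {l. alignments X Y l \<noteq> {}}"
    by (auto intro: finite_subset[of _ "{..length X}"])
  with assms show ?thesis
    by (simp add: lcs_length_def)
qed

text \<open>Turns an alignment given as a set back into coordinate functions;
  \<open>alignment_seq\<close> inspects them only on \<open>{1..k}\<close>, where sorting recovers
  the original values.\<close>

lemma alignment_seq_i_at_j_at:
  assumes "\<alpha> \<in> alignments X Y k"
  shows "alignment_seq X Y k (i_at \<alpha>) (j_at \<alpha>)"
proof -
  obtain i j where s: "alignment_seq X Y k i j" and \<alpha>: "\<alpha> = (\<lambda>t. (i t, j t)) ` {1..k}"
    using assms unfolding alignments_def by blast
  have "i_at \<alpha> t = i t" "j_at \<alpha> t = j t" if "t \<in> {1..k}" for t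
    using i_at_alignment[OF s that] j_at_alignment[OF s that] \<alpha> by auto
  with s show ?thesis
    by (simp add: alignment_seq_def strict_mono_on_def)
qed

lemma alignment_seq_splice:
  assumes a: "alignment_seq X Y k i j" and b: "alignment_seq X Y k i' j'"
    and t: "t \<in> {1..k}" and less: "i t < i' t" "j t < j' t"
  shows "alignment_seq X Y (Suc k)
    (\<lambda>s. if s \<le> t then i s else i' (s - 1)) (\<lambda>s. if s \<le> t then j s else j' (s - 1))"
proof -
  have mono: "(if r \<le> t then f r else g (r - 1)) < (if s \<le> t then f s else g (s - 1))"
    if f: "strict_mono_on {1..k} f" and g: "strict_mono_on {1..k} g" and fg: "f t < g t"
      and rs: "r \<in> {1..Suc k}" "s \<in> {1..Suc k}" "r < s" for f g :: "nat \<Rightarrow> nat" and r s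
  proof -
    consider "s \<le> t" | "r \<le> t" "t < s" | "t < r"
      by linarith
    then show ?thesis
    proof cases
      case 1
      then show ?thesis
        using rs t strict_mono_onD[OF f, of r s] by auto
    next
      \<comment> \<open>The only case mixing the two sequences: \<open>t \<le> s - 1\<close>, so the
        junction inequality \<open>f t < g t\<close> separates the values.\<close>
      case 2
      have "f r \<le> f t"
        using 2 rs t strict_mono_on_leD[OF f, of r t] by auto
      moreover have "g t \<le> g (s - 1)"
        using 2 rs t strict_mono_on_leD[OF g, of t "s - 1"] by auto
      ultimately show ?thesis
        using 2 fg by simp
    next
      case 3
      then show ?thesis
        using rs t strict_mono_onD[OF g, of "r - 1" "s - 1"] by auto
    qed
  qed
  have "s \<in> {1..k}" if "s \<in> {1..Suc k}" "s \<le> t" for s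
    using that t by auto
  moreover have "s - 1 \<in> {1..k}" if "s \<in> {1..Suc k}" "\<not> s \<le> t" for s
    using that t by auto
  ultimately show ?thesis
    using a b mono less unfolding alignment_seq_def by (auto intro!: strict_mono_onI)
qed

lemma optimal_alignments_no_domination:
  assumes "\<alpha> \<in> optimal_alignments X Y" "\<beta> \<in> optimal_alignments X Y"
    and "t \<in> {1..lcs_length X Y}" "i_at \<alpha> t < i_at \<beta> t"
  shows "j_at \<beta> t \<le> j_at \<alpha> t"
proof (rule ccontr)
  assume "\<not> j_at \<beta> t \<le> j_at \<alpha> t"
  then have "alignments X Y (Suc (lcs_length X Y)) \<noteq> {}"
    using alignment_seq_splice[OF alignment_seq_i_at_j_at alignment_seq_i_at_j_at assms(3,4)] assms(1,2)
    unfolding optimal_alignments_def alignments_def by fastforce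
  then show False
    using alignments_le_lcs_length by fastforce
qed

lemma optimal_alignment_mono:
  assumes "\<alpha> \<in> optimal_alignments X Y" "1 \<le> s" "s \<le> t" "t \<le> lcs_length X Y"
  shows "i_at \<alpha> s \<le> i_at \<alpha> t" "j_at \<alpha> s \<le> j_at \<alpha> t"
    and "s < t \<Longrightarrow> i_at \<alpha> s < i_at \<alpha> t" "s < t \<Longrightarrow> j_at \<alpha> s < j_at \<alpha> t"
proof -
  have "strict_mono_on {1..lcs_length X Y} (i_at \<alpha>)" "strict_mono_on {1..lcs_length X Y} (j_at \<alpha>)"
    using assms(1) alignment_seq_i_at_j_at unfolding optimal_alignments_def alignment_seq_def by blast+
  with assms show "i_at \<alpha> s \<le> i_at \<alpha> t" "j_at \<alpha> s \<le> j_at \<alpha> t"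
    and "s < t \<Longrightarrow> i_at \<alpha> s < i_at \<alpha> t" "s < t \<Longrightarrow> j_at \<alpha> s < j_at \<alpha> t"
    by (auto intro: strict_mono_on_leD strict_mono_onD)
qed

section \<open>Extremal pairs\<close>

lemma finite_optimal_alignments: "finite (optimal_alignments X Y)"
  by (simp add: optimal_alignments_def finite_alignments)

definition top_j :: "'a list \<Rightarrow> 'a list \<Rightarrow> nat \<Rightarrow> nat" where
  "top_j X Y t = Max {j_at \<alpha> t | \<alpha>. \<alpha> \<in> optimal_alignments X Y}"

definition top_i :: "'a list \<Rightarrow> 'a list \<Rightarrow> nat \<Rightarrow> nat" where
  "top_i X Y t = Min {i_at \<alpha> t | \<alpha>. j_at \<alpha> t = top_j X Y t \<and> \<alpha> \<in> optimal_alignments X Y}"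

lemma j_at_le_top_j:
  assumes "\<alpha> \<in> optimal_alignments X Y"
  shows "j_at \<alpha> t \<le> top_j X Y t"
  unfolding top_j_def using assms finite_optimal_alignments[of X Y]
  by (intro Max_ge) (auto simp: Setcompr_eq_image)

text \<open>One alignment attains both extrema because the minimum is taken among the maximisers. It
  may vary with \<open>t\<close>.\<close>

lemma top_attained:
  obtains \<alpha> where "\<alpha> \<in> optimal_alignments X Y" "i_at \<alpha> t = top_i X Y t" "j_at \<alpha> t = top_j X Y t"
proof -
  have "top_j X Y t \<in> {j_at \<alpha> t | \<alpha>. \<alpha> \<in> optimal_alignments X Y}"
    unfolding top_j_def using finite_optimal_alignments[of X Y] optimal_alignments_nonempty[of X Y]
    by (intro Max_in) auto
  then have "top_i X Y t \<in> {i_at \<alpha> t | \<alpha>. j_at \<alpha> t = top_j X Y t \<and> \<alpha> \<in> optimal_alignments X Y}"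
    unfolding top_i_def using finite_optimal_alignments[of X Y]
    by (intro Min_in) auto
  with that show thesis
    by auto
qed

lemma top_i_le_i_at:
  assumes \<alpha>: "\<alpha> \<in> optimal_alignments X Y" and t: "t \<in> {1..lcs_length X Y}"
  shows "top_i X Y t \<le> i_at \<alpha> t"
proof (rule ccontr)
  assume below: "\<not> top_i X Y t \<le> i_at \<alpha> t"
  obtain \<beta> where \<beta>: "\<beta> \<in> optimal_alignments X Y" "i_at \<beta> t = top_i X Y t" "j_at \<beta> t = top_j X Y t"
    by (rule top_attained)
  \<comment> \<open>Otherwise \<beta> would dominate \<alpha> at \<open>t\<close>; hence \<alpha>
    itself competes in the minimum defining \<open>top_i\<close>.\<close>
  have "j_at \<alpha> t = top_j X Y t"
    using optimal_alignments_no_domination[OF \<alpha> \<beta>(1) t] j_at_le_top_j[OF \<alpha>, of t] below \<beta> by simp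
  then have "top_i X Y t \<le> i_at \<alpha> t"
    unfolding top_i_def using \<alpha> finite_optimal_alignments[of X Y] by (intro Min_le) auto
  with below show False
    by simp
qed

text \<open>For \<open>i\<close> the witness is taken at \<open>t\<close>, since
  \<open>top_i\<close> is a lower bound at \<open>s\<close>; for \<open>j\<close> it is taken at
  \<open>s\<close>, since \<open>top_j\<close> is an upper bound at \<open>t\<close>.\<close>

lemma top_less:
  assumes "1 \<le> s" "s < t" "t \<le> lcs_length X Y"
  shows "top_i X Y s < top_i X Y t" "top_j X Y s < top_j X Y t"
proof -
  obtain \<alpha> where \<alpha>: "\<alpha> \<in> optimal_alignments X Y" "i_at \<alpha> t = top_i X Y t"
    by (rule top_attained)
  show "top_i X Y s < top_i X Y t"
    using top_i_le_i_at[OF \<alpha>(1), of s] optimal_alignment_mono(3)[OF \<alpha>(1), of s t] assms \<alpha>(2) by simp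
  obtain \<beta> where \<beta>: "\<beta> \<in> optimal_alignments X Y" "j_at \<beta> s = top_j X Y s"
    by (rule top_attained)
  show "top_j X Y s < top_j X Y t"
    using j_at_le_top_j[OF \<beta>(1), of t] optimal_alignment_mono(4)[OF \<beta>(1), of s t] assms \<beta>(2) by simp
qed

lemma alignment_seq_top:
  "alignment_seq X Y (lcs_length X Y) (top_i X Y) (top_j X Y)"
proof -
  \<comment> \<open>Range and matching letters concern one pair at a time, so a separate witness for
    each \<open>t\<close> suffices.\<close>
  have "top_i X Y t \<in> {1..length X} \<and> top_j X Y t \<in> {1..length Y}
      \<and> X ! (top_i X Y t - 1) = Y ! (top_j X Y t - 1)"
    if "t \<in> {1..lcs_length X Y}" for t
  proof -
    obtain \<alpha> where \<alpha>: "\<alpha> \<in> optimal_alignments X Y" "i_at \<alpha> t = top_i X Y t" "j_at \<alpha> t = top_j X Y t"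
      by (rule top_attained)
    have "alignment_seq X Y (lcs_length X Y) (i_at \<alpha>) (j_at \<alpha>)"
      using \<alpha>(1) unfolding optimal_alignments_def by (rule alignment_seq_i_at_j_at)
    with that \<alpha>(2,3) show ?thesis
      unfolding alignment_seq_def by metis
  qed
  then show ?thesis
    unfolding alignment_seq_def by (auto intro!: strict_mono_onI top_less)
qed

section \<open>One step of the recursion\<close>

lemma finite_setcompr_at:
  "finite {f \<alpha> l | \<alpha> l. P \<alpha> l \<and> \<alpha> \<in> optimal_alignments X Y \<and> l \<in> {1..k::nat}}"
proof (rule finite_subset)
  show "{f \<alpha> l | \<alpha> l. P \<alpha> l \<and> \<alpha> \<in> optimal_alignments X Y \<and> l \<in> {1..k}}
      \<subseteq> (\<lambda>(\<alpha>, l). f \<alpha> l) ` (optimal_alignments X Y \<times> {1..k})"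
    by auto
qed (simp add: finite_optimal_alignments)

lemma step_js_top:
  assumes t: "1 \<le> t" "t < lcs_length X Y"
  shows "finite (step_js X Y (top_i X Y (Suc t)))" "top_j X Y t \<in> step_js X Y (top_i X Y (Suc t))"
    and "Max (step_js X Y (top_i X Y (Suc t))) = top_j X Y t"
proof -
  show fin: "finite (step_js X Y (top_i X Y (Suc t)))"
    unfolding step_js_def by (rule finite_setcompr_at)
  obtain \<beta> where \<beta>: "\<beta> \<in> optimal_alignments X Y" "i_at \<beta> t = top_i X Y t" "j_at \<beta> t = top_j X Y t"
    by (rule top_attained)
  \<comment> \<open>The index \<open>l = t\<close> is admissible because \<open>top_i\<close>
    increases strictly from \<open>t\<close> to \<open>Suc t\<close>. Membership also gives the
    nonemptiness needed later.\<close>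
  then show mem: "top_j X Y t \<in> step_js X Y (top_i X Y (Suc t))"
    unfolding step_js_def using t top_less(1)[of t "Suc t" X Y]
    by (intro CollectI exI[of _ \<beta>] exI[of _ t]) auto
  have "j_at \<alpha> l \<le> top_j X Y t"
    if \<alpha>: "\<alpha> \<in> optimal_alignments X Y" and l: "l \<in> {1..lcs_length X Y}"
      and less: "i_at \<alpha> l < top_i X Y (Suc t)" for \<alpha> l
  proof -
    have "l \<le> t"
    proof (rule ccontr)
      assume "\<not> l \<le> t"
      then have "i_at \<alpha> (Suc t) \<le> i_at \<alpha> l"
        using l by (intro optimal_alignment_mono(1)[OF \<alpha>]) auto
      then show False
        using less t top_i_le_i_at[OF \<alpha>, of "Suc t"] by simp
    qed
    then show ?thesis
      using l t optimal_alignment_mono(2)[OF \<alpha>, of l t] j_at_le_top_j[OF \<alpha>, of t] by simp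
  qed
  then show "Max (step_js X Y (top_i X Y (Suc t))) = top_j X Y t"
    using fin mem by (intro Max_eqI) (auto simp: step_js_def)
qed

lemma step_is_top:
  assumes t: "t \<in> {1..lcs_length X Y}"
  shows "finite (step_is X Y (top_j X Y t))" "top_i X Y t \<in> step_is X Y (top_j X Y t)"
    and "Min (step_is X Y (top_j X Y t)) = top_i X Y t"
proof -
  show fin: "finite (step_is X Y (top_j X Y t))"
    unfolding step_is_def by (rule finite_setcompr_at)
  obtain \<beta> where \<beta>: "\<beta> \<in> optimal_alignments X Y" "i_at \<beta> t = top_i X Y t" "j_at \<beta> t = top_j X Y t"
    by (rule top_attained)
  with t show mem: "top_i X Y t \<in> step_is X Y (top_j X Y t)"
    unfolding step_is_def by (intro CollectI exI[of _ \<beta>] exI[of _ t]) auto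
  have "top_i X Y t \<le> i_at \<alpha> l"
    if \<alpha>: "\<alpha> \<in> optimal_alignments X Y" and l: "l \<in> {1..lcs_length X Y}"
      and eq: "j_at \<alpha> l = top_j X Y t" for \<alpha> l
  proof -
    have "t \<le> l"
    proof (rule ccontr)
      assume "\<not> t \<le> l"
      then have "j_at \<alpha> l < j_at \<alpha> t"
        using l t by (intro optimal_alignment_mono(4)[OF \<alpha>]) auto
      then show False
        using eq j_at_le_top_j[OF \<alpha>, of t] by simp
    qed
    \<comment> \<open>Here \<alpha> is not known to maximise the \<open>t\<close>-th
      \<open>j\<close>, so the bound on \<open>i\<close> over all optimal alignments is
      needed.\<close>
    then show ?thesis
      using l t optimal_alignment_mono(1)[OF \<alpha>, of t l] top_i_le_i_at[OF \<alpha> t] by simp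
  qed
  then show "Min (step_is X Y (top_j X Y t)) = top_i X Y t"
    using fin mem by (intro Min_eqI) (auto simp: step_is_def)
qed

section \<open>Output of the procedure\<close>

lemma highest_pair_eq_top:
  assumes "s < lcs_length X Y"
  shows "highest_pair X Y s = (top_i X Y (lcs_length X Y - s), top_j X Y (lcs_length X Y - s))"
  using assms
proof (induction s)
  \<comment> \<open>The starting sets are literally those defining the extremal pair at the last
    index.\<close>
  case 0
  then show ?case
    by (simp add: Let_def start_js_def start_is_def top_i_def top_j_def)
next
  case (Suc s)
  define t where "t = lcs_length X Y - Suc s"
  \<comment> \<open>The bound on \<open>Suc s\<close> keeps the index at least 1, so the truncated
    subtraction is exact.\<close>
  have t: "1 \<le> t" "t < lcs_length X Y" and Suc_t: "lcs_length X Y - s = Suc t"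
    using Suc.prems by (auto simp: t_def)
  have "fst (highest_pair X Y s) = top_i X Y (Suc t)"
    using Suc unfolding Suc_t by simp
  then show ?case
    unfolding t_def[symmetric] using t by (simp add: Let_def step_js_top step_is_top)
qed

lemma high_eq_top:
  assumes "t \<in> {1..lcs_length X Y}"
  shows "i_high X Y t = top_i X Y t" "j_high X Y t = top_j X Y t"
  using assms by (simp_all add: i_high_def j_high_def highest_pair_eq_top)

lemma highest_procedure_defined:
  assumes "lcs_length X Y \<ge> 1"
  shows "highest_procedure_defined X Y"
proof -
  let ?k = "lcs_length X Y"
  obtain \<alpha> where "\<alpha> \<in> optimal_alignments X Y" "j_at \<alpha> ?k = top_j X Y ?k"
    by (rule top_attained)
  then have "start_js X Y \<noteq> {}" "start_is X Y (top_j X Y ?k) \<noteq> {}"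
    by (auto simp: start_js_def start_is_def)
  moreover have "finite (start_js X Y)" "finite (start_is X Y (top_j X Y ?k))"
    using finite_optimal_alignments[of X Y] by (auto simp: start_js_def start_is_def)
  moreover have "finite (step_js X Y (top_i X Y (Suc t))) \<and> step_js X Y (top_i X Y (Suc t)) \<noteq> {}
      \<and> finite (step_is X Y (top_j X Y t)) \<and> step_is X Y (top_j X Y t) \<noteq> {}"
    if "t \<in> {1..<?k}" for t
    using that step_js_top(1,2)[of t X Y] step_is_top(1,2)[of t X Y] by auto
  ultimately show ?thesis
    using assms by (simp add: highest_procedure_defined_def Let_def high_eq_top)
qed

theorem proposition2p1:
  fixes X Y :: "'a::finite list" and n k :: nat
  assumes "length X = n" and "length Y = n"
    and "k = lcs_length X Y" and "k \<ge> 1"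
  shows "highest_procedure_defined X Y
    \<and> alignment_seq X Y k (i_high X Y) (j_high X Y)
    \<and> {(i_high X Y t, j_high X Y t) | t. t \<in> {1..k}} \<in> optimal_alignments X Y
    \<and> (\<forall>t\<in>{1..k}.
         j_high X Y t = Max {j_at \<alpha> t | \<alpha>. \<alpha> \<in> optimal_alignments X Y}
       \<and> i_high X Y t = Min {i_at \<alpha> t | \<alpha>. j_at \<alpha> t = j_high X Y t \<and> \<alpha> \<in> optimal_alignments X Y})"
proof -
  have high: "i_high X Y t = top_i X Y t" "j_high X Y t = top_j X Y t" if "t \<in> {1..k}" for t
    using that assms(3) high_eq_top by blast+
  \<comment> \<open>The equations \<open>high\<close> are available only on \<open>{1..k}\<close>,
    which is all that \<open>alignment_seq\<close> inspects.\<close>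
  have seq: "alignment_seq X Y k (i_high X Y) (j_high X Y)"
    using alignment_seq_top[of X Y] high assms(3) by (simp add: alignment_seq_def strict_mono_on_def)
  moreover from seq have "{(i_high X Y t, j_high X Y t) | t. t \<in> {1..k}} \<in> optimal_alignments X Y"
    unfolding optimal_alignments_def alignments_def assms(3)[symmetric] Setcompr_eq_image by blast
  moreover have "highest_procedure_defined X Y"
    using assms by (simp add: highest_procedure_defined)
  ultimately show ?thesis
    using high by (simp add: top_i_def top_j_def)
qed

end
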